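(* Let $d\ge 1$, let $G$ be a graph with $n\ge d+2$ vertices, and let $(G,p)$ be a framework in $\mathbb{R}^d$. Then $(G,p)$ is Gstressable if and only if $p$ has full ($d$-dimensional) affine span and $(G,p)$ has an equilibrium stress matrix belonging to $\mathrm{Gstr}$.
   Context: Graphs are finite and simple, with vertex set $\{1,\dots,n\}$. A framework $(G,p)$ in $\mathbb{R}^d$ is the graph $G$ with a configuration $p=(p_1,\dots,p_n)$ of points of $\mathbb{R}^d$. The configuration $p$ is in affine general position if no $k\le d+1$ of its points lie on a $(k-2)$-dimensional affine subspace. An equilibrium stress matrix of $(G,p)$ is a real symmetric $n\times n$ matrix $\Omega$ with $\Omega_{ij}=0$ whenever $i\neq j$ and $\{i,j\}$ is not an edge, with the all-ones vector in its kernel, and with $\sum_j\Omega_{ij}p_j=0$ for all $i$. $(G,p)$ is Gstressable if $p$ is in affine general position and $(G,p)$ has an equilibrium stress matrix of rank $n-d-1$. $\mathrm{Gstr}$ is the set of real symmetric $n\times n$ matrices $\Omega$ such that $\Omega_{ij}=0$ whenever $i\ne j$ and $\{i,j\}$ is not an edge of $G$; the all-ones vector is in the kernel of $\Omega$; $\operatorname{rank}\Omega=n-d-1$; and every subset of $n-d-1$ columns of $\Omega$ is linearly independent. *)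

theory Defs
  imports "HOL-Analysis.Analysis"
begin

text \<open>
  The vertices are the elements of a finite type \<open>'n\<close>, so \<open>n = CARD('n)\<close>; a graph is given by its
  set of edges, each edge being a two-element set of vertices. The ambient space is \<open>real ^ 'd\<close>,
  so \<open>d = CARD('d) \<ge> 1\<close>, and a configuration is a function \<open>p :: 'n \<Rightarrow> real ^ 'd\<close>.
\<close>

definition simple_graph :: "'n set set \<Rightarrow> bool" where
  "simple_graph E \<longleftrightarrow> (\<forall>e\<in>E. card e = 2)"

text \<open>
  The \<open>k\<close> points are the images of \<open>k\<close> distinct vertices, so repeated points are
  counted with multiplicity; in particular \<open>k = 2\<close> forces \<open>p\<close> to be injective. The empty affine
  subspace has dimension \<open>- 1\<close>, so \<open>k = 0\<close> and \<open>k = 1\<close> impose no condition.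
\<close>

definition affine_general_position :: "('n::finite \<Rightarrow> real ^ 'd) \<Rightarrow> bool" where
  "affine_general_position p \<longleftrightarrow>
     (\<forall>K. card K \<le> CARD('d) + 1 \<longrightarrow>
        \<not> (\<exists>A. affine A \<and> aff_dim A = int (card K) - 2 \<and> p ` K \<subseteq> A))"

definition equilibrium_stress_matrix ::
    "'n set set \<Rightarrow> ('n::finite \<Rightarrow> real ^ 'd) \<Rightarrow> real ^ 'n ^ 'n \<Rightarrow> bool" where
  "equilibrium_stress_matrix E p \<Omega> \<longleftrightarrow>
     transpose \<Omega> = \<Omega> \<and>
     (\<forall>i j. i \<noteq> j \<and> {i, j} \<notin> E \<longrightarrow> \<Omega> $ i $ j = 0) \<and>
     \<Omega> *v (\<chi> i. 1) = 0 \<and>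
     (\<forall>i. (\<Sum>j\<in>UNIV. \<Omega> $ i $ j *\<^sub>R p j) = 0)"

text \<open>
  In the next two definitions \<open>n - d - 1\<close> is a subtraction of natural numbers; they are intended
  for \<open>n \<ge> d + 1\<close>, where it does not truncate.
\<close>

definition Gstressable :: "'n set set \<Rightarrow> ('n::finite \<Rightarrow> real ^ 'd) \<Rightarrow> bool" where
  "Gstressable E p \<longleftrightarrow>
     affine_general_position p \<and>
     (\<exists>\<Omega>. equilibrium_stress_matrix E p \<Omega> \<and> rank \<Omega> = CARD('n) - CARD('d) - 1)"

text \<open>
  Linear independence of the columns indexed by \<open>J\<close> is that of an indexed family, hence the
  injectivity condition: two equal columns are linearly dependent.
\<close>

definition Gstr :: "nat \<Rightarrow> 'n set set \<Rightarrow> (real ^ 'n ^ 'n::finite) set" where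
  "Gstr d E = {\<Omega>.
     transpose \<Omega> = \<Omega> \<and>
     (\<forall>i j. i \<noteq> j \<and> {i, j} \<notin> E \<longrightarrow> \<Omega> $ i $ j = 0) \<and>
     \<Omega> *v (\<chi> i. 1) = 0 \<and>
     rank \<Omega> = CARD('n) - d - 1 \<and>
     (\<forall>J. card J = CARD('n) - d - 1 \<longrightarrow>
        inj_on (\<lambda>j. column j \<Omega>) J \<and> independent ((\<lambda>j. column j \<Omega>) ` J))}"

end

theory Submission
  imports Defs
begin

text \<open>
  When \<open>p\<close> has full affine span, the vectors \<open>(a \<bullet> p\<^sub>i + b)\<^sub>i\<close> form a space of dimension \<open>d + 1\<close>; they
  always lie in the kernel of a stress matrix \<open>\<Omega>\<close>, so they exhaust it when \<open>\<Omega>\<close> has rank \<open>n - d - 1\<close>.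
  A linear dependence among the columns indexed by \<open>J\<close> is a kernel vector vanishing off \<open>J\<close>. For
  \<open>card J = n - d - 1\<close> it is thus an affine function vanishing at the \<open>d + 1\<close> points outside \<open>J\<close>, and
  a nonzero such function exists exactly when these points lie on a hyperplane.
\<close>

text \<open>A hyperplane has dimension one below the ambient space, and every set of smaller affine
  dimension fits into one. This turns dimension conditions into conditions on zero sets of affine
  functions.\<close>

lemma aff_dim_eq_DIM_iff_no_hyperplane:
  fixes S :: "'a::euclidean_space set"
  shows "aff_dim S = int DIM('a) \<longleftrightarrow> (\<forall>a b. a \<noteq> 0 \<longrightarrow> \<not> S \<subseteq> {x. a \<bullet> x = b})"
proof
  assume full: "aff_dim S = int DIM('a)"
  show "\<forall>a b. a \<noteq> 0 \<longrightarrow> \<not> S \<subseteq> {x. a \<bullet> x = b}"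
  proof (intro allI impI notI)
    fix a :: 'a and b
    assume a: "a \<noteq> 0" and "S \<subseteq> {x. a \<bullet> x = b}"
    then have "aff_dim S \<le> aff_dim {x. a \<bullet> x = b}"
      by (intro aff_dim_subset)
    also have "\<dots> < int DIM('a)"
      using a by (simp add: Suc_leI)
    finally have "aff_dim S < int DIM('a)" .
    with full show False by simp
  qed
next
  assume "\<forall>a b. a \<noteq> 0 \<longrightarrow> \<not> S \<subseteq> {x. a \<bullet> x = b}"
  then have "\<not> aff_dim S < int DIM('a)"
    using aff_lowdim_subset_hyperplane[of S] by blast
  with aff_dim_le_DIM[of S] show "aff_dim S = int DIM('a)" by simp
qed

lemma aff_dim_Un_finite_le:
  assumes "finite T"
  shows "aff_dim (S \<union> T) \<le> aff_dim S + int (card T)"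
  using assms by (induction T) (auto simp: aff_dim_insert)

text \<open>Only sets of d + 1 vertices matter: a degenerate smaller set can be enlarged to that
  size, and it stays degenerate because each added point raises the affine dimension by at most
  one.\<close>

lemma affine_general_position_iff_no_hyperplane:
  fixes p :: "'n::finite \<Rightarrow> real ^ 'd"
  assumes "CARD('n) \<ge> CARD('d) + 1"
  shows "affine_general_position p \<longleftrightarrow>
    (\<forall>K a b. card K = CARD('d) + 1 \<and> a \<noteq> 0 \<longrightarrow> \<not> p ` K \<subseteq> {x. a \<bullet> x = b})"
    (is "_ \<longleftrightarrow> ?R")
proof
  assume gp: "affine_general_position p"
  show ?R
  proof (intro allI impI notI)
    fix K and a :: "real ^ 'd" and b
    assume K: "card K = CARD('d) + 1 \<and> a \<noteq> 0" and sub: "p ` K \<subseteq> {x. a \<bullet> x = b}"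
    from K have "aff_dim {x. a \<bullet> x = b} = int (card K) - 2"
      by simp
    with gp K sub affine_hyperplane[of a b] show False
      unfolding affine_general_position_def by (metis order_refl)
  qed
next
  assume R: ?R
  show "affine_general_position p"
    unfolding affine_general_position_def
  proof (intro allI impI notI)
    fix K :: "'n set"
    assume K: "card K \<le> CARD('d) + 1"
      and "\<exists>A. affine A \<and> aff_dim A = int (card K) - 2 \<and> p ` K \<subseteq> A"
    then have dimK: "aff_dim (p ` K) \<le> int (card K) - 2"
      using aff_dim_subset by metis
    obtain K' where K': "K \<subseteq> K'" "card K' = CARD('d) + 1"
      using exists_subset_between[of K "CARD('d) + 1" UNIV] K assms by auto
    have "aff_dim (p ` K') = aff_dim (p ` K \<union> p ` (K' - K))"
      using K' by (metis Un_Diff_cancel image_Un sup.absorb2)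
    also have "\<dots> \<le> aff_dim (p ` K) + int (card (p ` (K' - K)))"
      by (rule aff_dim_Un_finite_le) simp
    \<comment> \<open>Only an inequality, since \<open>p\<close> is not known to be injective
      here.\<close>
    also have "\<dots> \<le> aff_dim (p ` K) + int (card (K' - K))"
      by (simp add: card_image_le)
    also have "\<dots> = aff_dim (p ` K) + (int (card K') - int (card K))"
      using K K' by (simp add: card_Diff_subset del: of_nat_Suc)
    also have "\<dots> < int DIM(real ^ 'd)"
      using dimK K' by simp
    finally obtain a b where "a \<noteq> 0" "p ` K' \<subseteq> {x. a \<bullet> x = b}"
      using aff_lowdim_subset_hyperplane by metis
    with R K' show False by blast
  qed
qed

text \<open>The product \<open>A *v v\<close> is the combination of the columns with coefficients
  \<open>v\<close>, so a kernel vector supported on \<open>J\<close> is exactly a linear relation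
  among the columns indexed by \<open>J\<close>.\<close>

lemma independent_columns_iff:
  fixes A :: "real ^ 'n ^ 'm"
  shows "inj_on (\<lambda>j. column j A) J \<and> independent ((\<lambda>j. column j A) ` J) \<longleftrightarrow>
    (\<forall>v. A *v v = 0 \<and> (\<forall>j. j \<notin> J \<longrightarrow> v $ j = 0) \<longrightarrow> v = 0)"
    (is "?inj \<and> ?ind \<longleftrightarrow> ?ker")
proof -
  let ?c = "\<lambda>j. column j A"
  have mult: "A *v v = (\<Sum>j\<in>J. (v $ j) *\<^sub>R ?c j)" if "\<forall>j. j \<notin> J \<longrightarrow> v $ j = 0" for v
  proof -
    have "A *v v = (\<Sum>j\<in>UNIV. (v $ j) *\<^sub>R ?c j)"
      by (simp add: matrix_mult_sum scalar_mult_eq_scaleR)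
    also have "\<dots> = (\<Sum>j\<in>J. (v $ j) *\<^sub>R ?c j)"
      by (rule sum.mono_neutral_right) (auto simp: that)
    finally show ?thesis .
  qed
  show ?thesis
  proof
    assume "?inj \<and> ?ind"
    then have inj: ?inj and ind: ?ind by auto
    show ?ker
    proof (intro allI impI)
      fix v assume v: "A *v v = 0 \<and> (\<forall>j. j \<notin> J \<longrightarrow> v $ j = 0)"
      \<comment> \<open>Dependence of a set needs coefficients attached to vectors; injectivity
        carries them over from the indices.\<close>
      define u where "u = (\<lambda>x. v $ (the_inv_into J ?c x))"
      have "(\<Sum>x\<in>?c ` J. u x *\<^sub>R x) = (\<Sum>j\<in>J. (v $ j) *\<^sub>R ?c j)"
        unfolding sum.reindex[OF inj] by (rule sum.cong) (auto simp: u_def the_inv_into_f_f[OF inj])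
      also have "\<dots> = A *v v" using v by (intro mult[symmetric]) blast
      also have "\<dots> = 0" using v by simp
      finally have "(\<Sum>x\<in>?c ` J. u x *\<^sub>R x) = 0" .
      then have "\<forall>x\<in>?c ` J. u x = 0"
        using ind by (auto simp: dependent_finite)
      then have "\<forall>j\<in>J. v $ j = 0"
        by (auto simp: u_def the_inv_into_f_f[OF inj])
      with v show "v = 0" by (auto simp: vec_eq_iff)
    qed
  next
    assume ker: ?ker
    have inj: ?inj
    proof (rule inj_onI, rule ccontr)
      fix i j assume ij: "i \<in> J" "j \<in> J" "?c i = ?c j" "i \<noteq> j"
      \<comment> \<open>Two equal columns give a relation with coefficients 1 and -1.\<close>
      have "A *v (axis i 1 - axis j 1) = 0"
        using ij by (simp add: matrix_vector_mult_diff_distrib matrix_vector_mul_component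
            matrix_vector_mult_basis)
      with ker ij have "axis i (1::real) - axis j 1 = 0"
        by (auto simp: axis_def)
      with ij show False by (simp add: axis_eq_axis)
    qed
    have ?ind
    proof
      assume "dependent (?c ` J)"
      then obtain u k where k: "k \<in> J" "u (?c k) \<noteq> 0"
        and u: "(\<Sum>x\<in>?c ` J. u x *\<^sub>R x) = 0"
        by (auto simp: dependent_finite)
      define v where "v = (\<chi> j. if j \<in> J then u (?c j) else 0)"
      have "A *v v = (\<Sum>j\<in>J. u (?c j) *\<^sub>R ?c j)"
        by (simp add: mult v_def)
      also have "\<dots> = 0" using u inj by (simp add: sum.reindex)
      finally have "v = 0" using ker by (simp add: v_def)
      then have "v $ k = 0" by simp
      with k show False by (simp add: v_def)
    qed
    with inj show "?inj \<and> ?ind" ..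
  qed
qed

text \<open>The kernel is the orthogonal complement of the row space, whose dimension is the
  rank.\<close>

lemma dim_kernel_plus_rank:
  fixes A :: "real ^ 'n ^ 'm"
  shows "dim {v. A *v v = 0} + rank A = CARD('n)"
proof -
  have "A *v v = 0 \<longleftrightarrow> (\<forall>x\<in>rows A. orthogonal x v)" for v
    unfolding vec_eq_iff[of "A *v v"] rows_def row_def vec_lambda_eta orthogonal_def
    by (auto simp: matrix_vector_mul_component)
  then have "{v. A *v v = 0} = {v. \<forall>x\<in>span (rows A). orthogonal x v}"
    by (auto simp: orthogonal_commute span_base intro: orthogonal_to_span)
  then show ?thesis
    using dim_subspace_orthogonal_to_vectors[of "span (rows A)" "UNIV :: (real ^ 'n) set"]
    by (simp add: row_rank_def)
qed

text \<open>The equilibrium condition kills the linear part, and the all-ones kernel vector kills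
  the constant part.\<close>

lemma equilibrium_stress_matrix_affine_function_kernel:
  assumes "equilibrium_stress_matrix E p \<Omega>"
  shows "\<Omega> *v (\<chi> i. a \<bullet> p i + b) = 0"
proof -
  have "(\<Sum>j\<in>UNIV. \<Omega> $ i $ j * (a \<bullet> p j + b)) = 0" for i
  proof -
    have "(\<Sum>j\<in>UNIV. \<Omega> $ i $ j * (a \<bullet> p j + b)) =
        a \<bullet> (\<Sum>j\<in>UNIV. \<Omega> $ i $ j *\<^sub>R p j) + b * (\<Omega> *v (\<chi> i. 1)) $ i"
      by (simp add: inner_sum_right matrix_vector_mult_def sum_distrib_left
          sum.distrib algebra_simps)
    also have "\<dots> = 0"
      using assms unfolding equilibrium_stress_matrix_def by simp
    finally show ?thesis .
  qed
  then show ?thesis by (simp add: matrix_vector_mult_def vec_eq_iff)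
qed

text \<open>By a dimension count: evaluation of affine functions at the points is injective because
  the span is full, so its image in the kernel has dimension d + 1, which is the nullity of
  \<open>\<Omega>\<close>.\<close>

lemma equilibrium_stress_matrix_kernel:
  fixes p :: "'n::finite \<Rightarrow> real ^ 'd"
  assumes stress: "equilibrium_stress_matrix E p \<Omega>"
    and rank: "rank \<Omega> + CARD('d) + 1 = CARD('n)"
    and full: "aff_dim (range p) = int CARD('d)"
    and v: "\<Omega> *v v = 0"
  obtains a b where "v = (\<chi> i. a \<bullet> p i + b)"
proof -
  define f :: "(real ^ 'd) \<times> real \<Rightarrow> real ^ 'n" where "f = (\<lambda>(a, b). \<chi> i. a \<bullet> p i + b)"
  have lin: "linear f"
    by (rule linearI) (auto simp: f_def vec_eq_iff algebra_simps)
  have "inj f"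
    unfolding linear_injective_0[OF lin]
  proof (intro allI impI)
    fix x assume "f x = 0"
    then obtain a b where x: "x = (a, b)" and ab: "\<And>i. a \<bullet> p i + b = 0"
      by (cases x) (auto simp: f_def vec_eq_iff)
    have "range p \<subseteq> {y. a \<bullet> y = - b}"
      using ab by (auto simp: eq_neg_iff_add_eq_0)
    then have "a = 0"
      using full aff_dim_eq_DIM_iff_no_hyperplane[of "range p"] by auto
    with ab x show "x = 0" by (simp add: zero_prod_def)
  qed
  then have "dim (range f) = CARD('d) + 1"
    using dim_image_eq[OF lin, of UNIV] by simp
  moreover have "dim {w. \<Omega> *v w = 0} + rank \<Omega> = CARD('n)"
    by (rule dim_kernel_plus_rank)
  ultimately have "range f = {w. \<Omega> *v w = 0}"
    using rank equilibrium_stress_matrix_affine_function_kernel[OF stress]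
    by (intro subspace_dim_equal linear_subspace_image[OF lin])
      (auto simp: f_def subspace_def matrix_vector_right_distrib matrix_vector_mult_scaleR)
  with v obtain x where "v = f x" by blast
  then show thesis by (cases x) (auto simp: f_def intro: that)
qed

theorem lemma5p2:
  fixes E :: "'n::finite set set" and p :: "'n \<Rightarrow> real ^ 'd"
  assumes "simple_graph E"
    and "CARD('n) \<ge> CARD('d) + 2"
  shows "Gstressable E p \<longleftrightarrow>
    aff_dim (affine hull (range p)) = int CARD('d) \<and>
    (\<exists>\<Omega>. equilibrium_stress_matrix E p \<Omega> \<and> \<Omega> \<in> Gstr CARD('d) E)"
proof
  assume "Gstressable E p"
  then obtain \<Omega> where stress: "equilibrium_stress_matrix E p \<Omega>"
    and rank: "rank \<Omega> = CARD('n) - CARD('d) - 1"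
    and gp: "\<And>K a b. card K = CARD('d) + 1 \<Longrightarrow> a \<noteq> 0 \<Longrightarrow> \<not> p ` K \<subseteq> {x. a \<bullet> x = b}"
    using assms(2) unfolding Gstressable_def
    by (auto simp: affine_general_position_iff_no_hyperplane)
  \<comment> \<open>One set of d + 1 points off every hyperplane already forces full affine
    span.\<close>
  obtain K :: "'n set" where "card K = CARD('d) + 1"
    using obtain_subset_with_card_n[of "CARD('d) + 1" "UNIV :: 'n set"] assms(2) by auto
  then have "\<not> range p \<subseteq> {x. a \<bullet> x = b}" if "a \<noteq> 0" for a b
    using gp[of K a b] that by blast
  then have full: "aff_dim (range p) = int CARD('d)"
    using aff_dim_eq_DIM_iff_no_hyperplane[of "range p"] by simp
  have "v = 0"
    if J: "card J = CARD('n) - CARD('d) - 1" and v: "\<Omega> *v v = 0" "\<forall>j. j \<notin> J \<longrightarrow> v $ j = 0"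
    for J v
  proof -
    obtain a b where ab: "v = (\<chi> i. a \<bullet> p i + b)"
      using equilibrium_stress_matrix_kernel[OF stress _ full v(1)] rank assms(2) by auto
    have card: "card (- J) = CARD('d) + 1"
      using J assms(2) by (simp add: Compl_eq_Diff_UNIV card_Diff_subset)
    have zero: "a \<bullet> p i + b = 0" if "i \<in> - J" for i
      using v(2) that ab by (metis ComplD vec_lambda_beta)
    then have "p ` (- J) \<subseteq> {x. a \<bullet> x = - b}"
      by (auto simp: eq_neg_iff_add_eq_0)
    with gp card have "a = 0" by blast
    \<comment> \<open>With \<open>a = 0\<close> the affine function is the constant
      \<open>b\<close>, so a single zero outside \<open>J\<close> settles it.\<close>
    moreover from card obtain i where "i \<in> - J"
      by (metis Suc_eq_plus1 card.empty nat.distinct(1) equals0I)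
    ultimately have "b = 0" using zero[of i] by simp
    with \<open>a = 0\<close> ab have "v = (\<chi> i. 0)" by simp
    then show ?thesis by (simp add: zero_vec_def)
  qed
  then have "\<Omega> \<in> Gstr CARD('d) E"
    using stress rank
    unfolding Gstr_def equilibrium_stress_matrix_def independent_columns_iff by auto
  with full stress show "aff_dim (affine hull (range p)) = int CARD('d) \<and>
    (\<exists>\<Omega>. equilibrium_stress_matrix E p \<Omega> \<and> \<Omega> \<in> Gstr CARD('d) E)"
    by (auto simp: aff_dim_affine_hull)
next
  assume "aff_dim (affine hull (range p)) = int CARD('d) \<and>
    (\<exists>\<Omega>. equilibrium_stress_matrix E p \<Omega> \<and> \<Omega> \<in> Gstr CARD('d) E)"
  then obtain \<Omega> where full: "aff_dim (range p) = int CARD('d)"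
    and stress: "equilibrium_stress_matrix E p \<Omega>"
    and rank: "rank \<Omega> = CARD('n) - CARD('d) - 1"
    and cols: "\<And>J v. card J = CARD('n) - CARD('d) - 1 \<Longrightarrow> \<Omega> *v v = 0 \<Longrightarrow>
      \<forall>j. j \<notin> J \<longrightarrow> v $ j = 0 \<Longrightarrow> v = 0"
    unfolding Gstr_def independent_columns_iff by (auto simp: aff_dim_affine_hull)
  have "\<not> p ` K \<subseteq> {x. a \<bullet> x = b}" if K: "card K = CARD('d) + 1" and a: "a \<noteq> 0" for K a b
  proof
    \<comment> \<open>The values of \<open>a \<bullet> x - b\<close> at the points form a kernel
      vector supported on the n - d - 1 indices in \<open>- K\<close>. Independence of those columns
      makes it zero, so all points lie on the hyperplane, against full span.\<close>
    assume sub: "p ` K \<subseteq> {x. a \<bullet> x = b}"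
    have "card (- K) = CARD('n) - CARD('d) - 1"
      using K by (simp add: Compl_eq_Diff_UNIV card_Diff_subset)
    moreover have "\<forall>i. i \<notin> - K \<longrightarrow> (\<chi> i. a \<bullet> p i + - b) $ i = 0"
      using sub by (simp add: image_subset_iff)
    ultimately have "(\<chi> i. a \<bullet> p i + - b) = 0"
      by (rule cols[OF _ equilibrium_stress_matrix_affine_function_kernel[OF stress]])
    then have "range p \<subseteq> {x. a \<bullet> x = b}"
      by (simp add: vec_eq_iff image_subset_iff)
    with a full show False
      using aff_dim_eq_DIM_iff_no_hyperplane[of "range p"] by auto
  qed
  with stress rank assms(2) show "Gstressable E p"
    unfolding Gstressable_def by (auto simp: affine_general_position_iff_no_hyperplane)
qed

end
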